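(* Let $\mathcal{H}$ be a complex Hilbert space and let $U$ be a unitary operator on $\mathcal{H}$. For $x,y\in\mathcal{H}$, $N\in\mathbb{N}$ and $f\in C(T)$ put $$F^N_{x,y}(f)=\frac{1}{N+1}\,\frac{1}{2\pi}\int_{[0,2\pi)}\langle T_N(t)x,T_N(t)y\rangle f(e^{it})\,dt,\qquad T_N(t)=\sum_{n=0}^N e^{-itn}U^n.$$ Then for every continuous function $f\in C(T)$ there exists a bounded operator on $\mathcal{H}$, denoted by $f(U)$, such that for all $x,y\in\mathcal{H}$ $$\lim_{N\to\infty}F^N_{x,y}(f)=\langle f(U)x,y\rangle.$$
   Context: $\langle\cdot,\cdot\rangle$ denotes the inner product of $\mathcal{H}$, linear in the first variable and conjugate-linear in the second. $T$ denotes the unit circle in $\mathbb{C}$, and $C(T)$ is the Banach space of complex continuous functions on $T$ with the supremum norm $\|\cdot\|_\infty$. *)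

theory Defs
  imports "HOL-Analysis.Analysis"
begin

text \<open>
  Complex Hilbert spaces. The inner product is linear in the first and conjugate-linear in the
  second argument. Norm, distance and topology are inherited from \<^class>\<open>real_normed_vector\<close>,
  and the axioms \<open>scaleR_scaleC\<close> and \<open>norm_eq_sqrt_cinner\<close> tie them to the complex structure.
\<close>

class complex_inner = real_normed_vector +
  fixes scaleC :: "complex \<Rightarrow> 'a \<Rightarrow> 'a"  (infixr "*\<^sub>C" 75)
    and cinner :: "'a \<Rightarrow> 'a \<Rightarrow> complex"
  assumes scaleC_add_right: "c *\<^sub>C (x + y) = c *\<^sub>C x + c *\<^sub>C y"
    and scaleC_add_left: "(c + d) *\<^sub>C x = c *\<^sub>C x + d *\<^sub>C x"
    and scaleC_scaleC: "c *\<^sub>C d *\<^sub>C x = (c * d) *\<^sub>C x"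
    and scaleC_one: "1 *\<^sub>C x = x"
    and scaleR_scaleC: "scaleR r x = complex_of_real r *\<^sub>C x"
    and cinner_commute: "cinner x y = cnj (cinner y x)"
    and cinner_add_left: "cinner (x + y) z = cinner x z + cinner y z"
    and cinner_scaleC_left: "cinner (c *\<^sub>C x) y = c * cinner x y"
    and cinner_self_nonneg: "0 \<le> Re (cinner x x)"
    and cinner_self_eq_zero_iff: "cinner x x = 0 \<longleftrightarrow> x = 0"
    and norm_eq_sqrt_cinner: "norm x = sqrt (Re (cinner x x))"

class complex_hilbert_space = complex_inner + complete_space

instantiation complex :: complex_hilbert_space
begin

definition scaleC_complex_def: "c *\<^sub>C (x::complex) = c * x"

definition cinner_complex_def: "cinner (x::complex) y = x * cnj y"

instance
proof
  fix r :: real and c d x y z :: complex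
  show "c *\<^sub>C (x + y) = c *\<^sub>C x + c *\<^sub>C y" "(c + d) *\<^sub>C x = c *\<^sub>C x + d *\<^sub>C x"
    "c *\<^sub>C d *\<^sub>C x = (c * d) *\<^sub>C x" "1 *\<^sub>C x = x"
    by (simp_all add: scaleC_complex_def distrib_left distrib_right mult.assoc)
  show "scaleR r x = complex_of_real r *\<^sub>C x"
    by (simp add: scaleC_complex_def scaleR_conv_of_real)
  show "cinner x y = cnj (cinner y x)" "cinner (x + y) z = cinner x z + cinner y z"
    "cinner (c *\<^sub>C x) y = c * cinner x y"
    by (simp_all add: scaleC_complex_def cinner_complex_def distrib_right)
  have *: "Re (cinner x x) = (norm x)\<^sup>2"
    unfolding cinner_complex_def complex_norm_square [symmetric] by simp
  show "0 \<le> Re (cinner x x)" "norm x = sqrt (Re (cinner x x))"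
    unfolding * by simp_all
  show "cinner x x = 0 \<longleftrightarrow> x = 0"
    by (simp add: cinner_complex_def)
qed

end

lemma vector_space_scaleC:
  "vector_space (scaleC :: complex \<Rightarrow> 'a::complex_inner \<Rightarrow> 'a)"
  by standard (simp_all add: scaleC_add_right scaleC_add_left scaleC_scaleC scaleC_one)

definition bounded_clinear :: "('a::complex_inner \<Rightarrow> 'b::complex_inner) \<Rightarrow> bool" where
  "bounded_clinear A \<longleftrightarrow>
     Vector_Spaces.linear scaleC scaleC A \<and> (\<exists>K. \<forall>x. norm (A x) \<le> K * norm x)"

definition is_adjoint_of :: "('a::complex_inner \<Rightarrow> 'a) \<Rightarrow> ('a \<Rightarrow> 'a) \<Rightarrow> bool" where
  "is_adjoint_of B A \<longleftrightarrow> bounded_clinear B \<and> (\<forall>x y. cinner (A x) y = cinner x (B y))"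

definition unitary_operator :: "('a::complex_hilbert_space \<Rightarrow> 'a) \<Rightarrow> bool" where
  "unitary_operator U \<longleftrightarrow>
     bounded_clinear U \<and> (\<exists>V. is_adjoint_of V U \<and> V \<circ> U = id \<and> U \<circ> V = id)"

definition trig_op :: "('a::complex_inner \<Rightarrow> 'a) \<Rightarrow> nat \<Rightarrow> real \<Rightarrow> 'a \<Rightarrow> 'a" where
  "trig_op U N t x = (\<Sum>n=0..N. exp (- \<i> * of_real t * of_nat n) *\<^sub>C (U ^^ n) x)"

definition fejer_form ::
  "('a::complex_inner \<Rightarrow> 'a) \<Rightarrow> nat \<Rightarrow> 'a \<Rightarrow> 'a \<Rightarrow> (complex \<Rightarrow> complex) \<Rightarrow> complex" where
  "fejer_form U N x y f =
     1 / (of_nat N + 1) * (1 / (2 * of_real pi)) *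
     (LINT t:{0..<2 * pi}|lborel.
        cinner (trig_op U N t x) (trig_op U N t y) * f (exp (\<i> * of_real t)))"

end

theory Submission
  imports Defs
begin

text \<open>
  On a monomial \<open>z^k\<close> the Fejer form can be computed. Expanding the inner product under the integral,
  unitarity turns \<open>\<langle>U^n x, U^m y\<rangle>\<close> into \<open>\<langle>U^(n - m) x, y\<rangle>\<close>, and orthogonality of the exponentials
  keeps exactly the pairs with \<open>n - m = k\<close>. There are \<open>N + 1 - \<bar>k\<bar>\<close> of them once \<open>N \<ge> \<bar>k\<bar>\<close>, so
  the form is the Cesaro weight \<open>1 - \<bar>k\<bar>/(N + 1)\<close> times \<open>\<langle>U^k x, y\<rangle>\<close> and converges to \<open>\<langle>U^k x, y\<rangle>\<close>.
  By linearity every trigonometric polynomial \<open>p\<close> has an operator \<open>p(U)\<close> (\<open>represents_powi\<close>,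
  \<open>represents_laurent_polynomial\<close>).

  The passage to continuous \<open>f\<close> rests on one estimate that is uniform in \<open>N\<close>. The case \<open>k = 0\<close>
  above says that the mean of \<open>\<parallel>T_N(t) x\<parallel>\<^sup>2\<close> over the circle is \<open>(N + 1) \<parallel>x\<parallel>\<^sup>2\<close>, whence
  \<open>\<bar>F^N_{x,y}(f)\<bar> \<le> M (\<parallel>x\<parallel>\<^sup>2 + \<parallel>y\<parallel>\<^sup>2) / 2\<close> if \<open>\<bar>f\<bar> \<le> M\<close> on the circle (\<open>cmod_fejer_form_le\<close>).
  In the limit this gives \<open>\<parallel>p(U) x\<parallel> \<le> M \<parallel>x\<parallel>\<close> for every \<open>p\<close> with \<open>\<bar>p\<bar> \<le> M\<close> on the circle.
  If trigonometric polynomials \<open>p_j\<close> converge uniformly to \<open>f\<close>, then \<open>p_j(U) x\<close> is therefore a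
  Cauchy sequence. Completeness provides its limit \<open>f(U) x\<close>, and the limits in \<open>j\<close> and in \<open>N\<close> may be
  interchanged because the forms of \<open>p_j\<close> converge to those of \<open>f\<close> uniformly in \<open>N\<close>
  (\<open>represents_uniform_limit\<close>). This replaces the Riesz representation of the limiting sesquilinear
  form by a direct construction. Approximating polynomials exist by the Stone-Weierstrass theorem: a
  real polynomial in \<open>Re z\<close> and \<open>Im z\<close> is a Laurent polynomial on the circle, where \<open>cnj z = 1/z\<close>.
\<close>

section \<open>Inner product spaces\<close>

lemma scaleC_zero_left: "0 *\<^sub>C x = (0::'a::complex_inner)"
  using scaleR_scaleC[of 0 x] by simp

lemma uminus_eq_scaleC: "- x = (- 1) *\<^sub>C (x::'a::complex_inner)"
  using scaleR_scaleC[of "- 1" x] by simp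

lemma cinner_add_right: "cinner x (y + z) = cinner x y + cinner x (z::'a::complex_inner)"
  unfolding cinner_commute[of x] by (simp add: cinner_add_left)

lemma cinner_scaleC_right: "cinner x (c *\<^sub>C y) = cnj c * cinner x (y::'a::complex_inner)"
  unfolding cinner_commute[of x] by (simp add: cinner_scaleC_left)

lemma cinner_zero_left: "cinner 0 (y::'a::complex_inner) = 0"
  using cinner_add_left[of 0 0 y] by simp

lemma cinner_zero_right: "cinner (x::'a::complex_inner) 0 = 0"
  using cinner_add_right[of x 0 0] by simp

lemma cinner_minus_left: "cinner (- x) (y::'a::complex_inner) = - cinner x y"
  unfolding uminus_eq_scaleC[of x] cinner_scaleC_left by simp

lemma cinner_diff_left: "cinner (x - z) (y::'a::complex_inner) = cinner x y - cinner z y"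
  using cinner_add_left[of x "- z" y] by (simp add: cinner_minus_left)

lemma cinner_diff_right: "cinner (x::'a::complex_inner) (y - z) = cinner x y - cinner x z"
  unfolding cinner_commute[of x] by (simp add: cinner_diff_left)

lemma cinner_sum_left: "cinner (\<Sum>i\<in>I. f i) (y::'a::complex_inner) = (\<Sum>i\<in>I. cinner (f i) y)"
  by (induction I rule: infinite_finite_induct) (simp_all add: cinner_zero_left cinner_add_left)

lemma cinner_sum_right: "cinner (x::'a::complex_inner) (\<Sum>i\<in>I. f i) = (\<Sum>i\<in>I. cinner x (f i))"
  by (induction I rule: infinite_finite_induct) (simp_all add: cinner_zero_right cinner_add_right)

lemma cinner_self: "cinner x x = of_real ((norm (x::'a::complex_inner))\<^sup>2)"
proof -
  have "Im (cinner x x) = 0"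
    using arg_cong[OF cinner_commute[of x x], of Im] by simp
  thus ?thesis
    by (simp add: complex_eq_iff norm_eq_sqrt_cinner cinner_self_nonneg)
qed

lemma norm_scaleC: "norm (c *\<^sub>C x) = cmod c * norm (x::'a::complex_inner)"
proof -
  have "complex_of_real ((norm (c *\<^sub>C x))\<^sup>2) = (c * cnj c) * cinner x x"
    unfolding cinner_self[symmetric] by (simp add: cinner_scaleC_left cinner_scaleC_right)
  also have "\<dots> = of_real ((cmod c * norm x)\<^sup>2)"
    by (simp add: cinner_self complex_norm_square[symmetric] power_mult_distrib)
  finally have "(norm (c *\<^sub>C x))\<^sup>2 = (cmod c * norm x)\<^sup>2"
    by (simp only: of_real_eq_iff)
  thus ?thesis
    by (simp add: power2_eq_iff_nonneg)
qed

text \<open>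
  Expanding \<open>0 \<le> \<parallel>w x - y\<parallel>\<^sup>2\<close>, where the unimodular number \<open>w\<close> rotates the inner product onto the
  nonnegative real axis. This additive form of the Cauchy-Schwarz inequality is the one that can be
  integrated without applying a second Cauchy-Schwarz inequality to the integral.
\<close>
lemma cmod_cinner_le_mean:
  fixes x y :: "'a::complex_inner"
  shows "cmod (cinner x y) \<le> ((norm x)\<^sup>2 + (norm y)\<^sup>2) / 2"
proof -
  define w where "w = (if cinner x y = 0 then 1 else cnj (sgn (cinner x y)))"
  have w: "w * cinner x y = of_real (cmod (cinner x y))"
  proof (cases "cinner x y = 0")
    case False
    have "w * cinner x y = cinner x y * cnj (cinner x y) / of_real (cmod (cinner x y))"
      using False by (simp add: w_def sgn_eq)
    also have "\<dots> = of_real (cmod (cinner x y))"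
      unfolding complex_norm_square[symmetric] using False by (simp add: power2_eq_square)
    finally show ?thesis .
  qed simp
  have nw: "cmod w = 1"
    by (simp add: w_def norm_sgn)
  have "complex_of_real ((norm (w *\<^sub>C x - y))\<^sup>2) =
      cinner (w *\<^sub>C x) (w *\<^sub>C x) + cinner y y - (cinner (w *\<^sub>C x) y + cinner y (w *\<^sub>C x))"
    unfolding cinner_self[symmetric] by (simp add: cinner_diff_left cinner_diff_right)
  also have "\<dots> = of_real ((norm (w *\<^sub>C x))\<^sup>2 + (norm y)\<^sup>2) - (w * cinner x y + cnj (w * cinner x y))"
    unfolding cinner_commute[of y "w *\<^sub>C x"] cinner_scaleC_left[of w x y] of_real_add cinner_self ..
  also have "\<dots> = of_real ((norm x)\<^sup>2 + (norm y)\<^sup>2 - 2 * cmod (cinner x y))"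
    unfolding w by (simp add: norm_scaleC nw)
  finally have "(norm (w *\<^sub>C x - y))\<^sup>2 = (norm x)\<^sup>2 + (norm y)\<^sup>2 - 2 * cmod (cinner x y)"
    by (simp only: of_real_eq_iff)
  moreover have "0 \<le> (norm (w *\<^sub>C x - y))\<^sup>2"
    by simp
  ultimately show ?thesis
    by simp
qed

text \<open>
  The additive inequality for the normalised vectors.
\<close>
lemma Cauchy_Schwarz_cinner:
  fixes x y :: "'a::complex_inner"
  shows "cmod (cinner x y) \<le> norm x * norm y"
proof (cases "x = 0 \<or> y = 0")
  case True
  thus ?thesis
    by (auto simp: cinner_zero_left cinner_zero_right)
next
  case False
  let ?u = "complex_of_real (1 / norm x) *\<^sub>C x" and ?v = "complex_of_real (1 / norm y) *\<^sub>C y"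
  have "norm ?u = 1" "norm ?v = 1"
    unfolding norm_scaleC norm_of_real using False by simp_all
  hence "cmod (cinner ?u ?v) \<le> 1"
    using cmod_cinner_le_mean[of ?u ?v] by simp
  moreover have "cmod (cinner ?u ?v) = cmod (cinner x y) / (norm x * norm y)"
    unfolding cinner_scaleC_left cinner_scaleC_right norm_mult complex_mod_cnj norm_of_real by simp
  ultimately show ?thesis
    using False by (simp add: pos_divide_le_eq)
qed

lemma tendsto_cinner_left:
  fixes a :: "'a::complex_inner"
  assumes "(f \<longlongrightarrow> a) F"
  shows "((\<lambda>j. cinner (f j) y) \<longlongrightarrow> cinner a y) F"
proof -
  have "bounded_linear (\<lambda>x. cinner x y)"
    by (rule bounded_linear_intro[where K = "norm y"])
       (simp_all only: cinner_add_left scaleR_scaleC[where 'a = 'a] cinner_scaleC_left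
        scaleR_conv_of_real Cauchy_Schwarz_cinner)
  thus ?thesis
    using assms by (rule bounded_linear.tendsto)
qed

lemma cinner_left_cong:
  fixes a b :: "'a::complex_inner"
  assumes "\<And>y. cinner a y = cinner b y"
  shows "a = b"
proof -
  have "cinner (a - b) (a - b) = 0"
    using assms[of "a - b"] by (simp add: cinner_diff_left)
  thus ?thesis
    by (simp add: cinner_self_eq_zero_iff)
qed

text \<open>
  Taking for \<open>y\<close> the multiple of \<open>a\<close> that has the norm of \<open>x\<close> makes the mean of squares equal to
  \<open>\<parallel>x\<parallel>\<^sup>2\<close>, so the additive bound yields the homogeneous one. For \<open>x = 0\<close> there is no such \<open>y\<close>
  unless \<open>a = 0\<close>.
\<close>
lemma norm_le_of_cinner_le_mean:
  fixes a x :: "'a::complex_inner"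
  assumes "\<And>y. cmod (cinner a y) \<le> M * (((norm x)\<^sup>2 + (norm y)\<^sup>2) / 2)"
    and "x = 0 \<Longrightarrow> a = 0" and "0 \<le> M"
  shows "norm a \<le> M * norm x"
proof (cases "a = 0 \<or> x = 0")
  case True
  thus ?thesis
    using assms by auto
next
  case False
  define y where "y = (norm x / norm a) *\<^sub>R a"
  have "norm y = norm x"
    using False by (simp add: y_def)
  moreover have "cinner a y = of_real (norm x / norm a * (norm a)\<^sup>2)"
    unfolding y_def scaleR_scaleC cinner_scaleC_right cinner_self by simp
  hence "cmod (cinner a y) = norm x * norm a"
    using False by (simp add: power2_eq_square norm_mult)
  ultimately have "norm x * norm a \<le> norm x * (M * norm x)"
    using assms(1)[of y] by (simp add: power2_eq_square mult_ac)
  thus ?thesis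
    using False by simp
qed

section \<open>Bounded operators and powers of a unitary\<close>

lemma bounded_clinear_iff:
  "bounded_clinear A \<longleftrightarrow> (\<forall>x y. A (x + y) = A x + A y) \<and> (\<forall>c x. A (c *\<^sub>C x) = c *\<^sub>C A x) \<and>
    (\<exists>K. \<forall>x. norm (A x) \<le> K * norm x)"
  unfolding bounded_clinear_def Vector_Spaces.linear_iff
  by (simp add: vector_space_scaleC)

lemma bounded_clinear_zero: "bounded_clinear A \<Longrightarrow> A 0 = 0"
  unfolding bounded_clinear_iff by (metis scaleC_zero_left)

lemma bounded_clinear_add:
  assumes "bounded_clinear A" "bounded_clinear B"
  shows "bounded_clinear (\<lambda>x. A x + B x)"
proof -
  obtain K L where "\<And>x. norm (A x) \<le> K * norm x" "\<And>x. norm (B x) \<le> L * norm x"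
    using assms unfolding bounded_clinear_iff by blast
  hence "norm (A x + B x) \<le> (K + L) * norm x" for x
    using order.trans[OF norm_triangle_ineq[of "A x" "B x"] add_mono] by (simp add: distrib_right)
  thus ?thesis
    using assms unfolding bounded_clinear_iff
    by (auto simp: scaleC_add_right)
qed

lemma bounded_clinear_scaleC:
  assumes "bounded_clinear A"
  shows "bounded_clinear (\<lambda>x. c *\<^sub>C A x)"
proof -
  obtain K where "\<And>x. norm (A x) \<le> K * norm x"
    using assms unfolding bounded_clinear_iff by blast
  hence "norm (c *\<^sub>C A x) \<le> (cmod c * K) * norm x" for x
    by (simp add: norm_scaleC mult_left_mono mult.assoc)
  hence "\<exists>K. \<forall>x. norm (c *\<^sub>C A x) \<le> K * norm x"
    by blast
  thus ?thesis
    using assms unfolding bounded_clinear_iff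
    by (simp add: scaleC_add_right scaleC_scaleC mult.commute)
qed

lemma bounded_clinear_isometry_power:
  fixes A :: "'a::complex_inner \<Rightarrow> 'a"
  assumes "bounded_clinear A" "\<And>x. norm (A x) = norm x"
  shows "bounded_clinear (A ^^ n)"
proof -
  have "norm ((A ^^ n) x) = norm x" for x
    by (induction n) (simp_all add: assms(2))
  moreover have "(A ^^ n) (x + y) = (A ^^ n) x + (A ^^ n) y" for x y
    using assms(1) by (induction n) (simp_all add: bounded_clinear_iff)
  moreover have "(A ^^ n) (c *\<^sub>C x) = c *\<^sub>C (A ^^ n) x" for c x
    using assms(1) by (induction n) (simp_all add: bounded_clinear_iff)
  ultimately show ?thesis
    unfolding bounded_clinear_iff by (auto intro: exI[of _ 1])
qed

text \<open>
  The family \<open>W\<close> consists of the integer powers of \<open>U\<close>; the negative ones are powers of its adjoint,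
  which is its inverse. What matters about them is that \<open>\<langle>U^n x, U^m y\<rangle>\<close> depends on \<open>n\<close> and \<open>m\<close> only
  through \<open>n - m\<close>.
\<close>
lemma unitary_operator_powersE:
  assumes "unitary_operator U"
  obtains W :: "int \<Rightarrow> 'a::complex_hilbert_space \<Rightarrow> 'a"
  where "\<And>k. bounded_clinear (W k)" "W 0 = id"
    "\<And>n m x y. cinner ((U ^^ n) x) ((U ^^ m) y) = cinner (W (int n - int m) x) y"
proof -
  obtain V where V: "bounded_clinear V" "\<And>x y. cinner (U x) y = cinner x (V y)"
      "\<And>x. V (U x) = x" "\<And>x. U (V x) = x"
    using assms unfolding unitary_operator_def is_adjoint_of_def fun_eq_iff by auto
  have U: "bounded_clinear U"
    using assms by (simp add: unitary_operator_def)
  have UU: "cinner (U x) (U y) = cinner x y" for x y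
    by (simp add: V)
  have VV: "cinner (V x) y = cinner x (U y)" for x y
    using V(4)[of x] UU by metis
  have normU: "norm (U x) = norm x" for x
    by (simp add: norm_eq_sqrt_cinner UU)
  have normV: "norm (V x) = norm x" for x
    using normU[of "V x"] V(4) by simp
  define W where "W k = (if 0 \<le> k then U ^^ nat k else V ^^ nat (- k))" for k
  have iso: "cinner ((U ^^ n) x) ((U ^^ n) y) = cinner x y" for n x y
    by (induction n) (simp_all add: UU)
  have adj: "cinner ((V ^^ n) x) y = cinner x ((U ^^ n) y)" for n x y
    by (induction n arbitrary: y) (simp_all add: VV funpow_swap1[of U])
  have "cinner ((U ^^ n) x) ((U ^^ m) y) = cinner (W (int n - int m) x) y" for n m x y
  proof (cases "m \<le> n")
    case True
    hence "(U ^^ n) x = (U ^^ m) ((U ^^ (n - m)) x)"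
      by (metis funpow_add comp_apply le_add_diff_inverse)
    thus ?thesis
      using True by (simp add: iso W_def nat_diff_distrib')
  next
    case False
    hence "(U ^^ m) y = (U ^^ n) ((U ^^ (m - n)) y)"
      by (metis funpow_add comp_apply le_add_diff_inverse nat_le_linear)
    thus ?thesis
      using False by (simp add: iso W_def nat_diff_distrib' adj)
  qed
  moreover have "bounded_clinear (W k)" for k
    by (simp add: W_def bounded_clinear_isometry_power U V normU normV)
  moreover have "W 0 = id"
    by (simp add: W_def)
  ultimately show thesis
    by (rule that[rotated -1])
qed

section \<open>The Fejer forms\<close>

lemma continuous_on_circle_param:
  fixes f :: "complex \<Rightarrow> 'b::topological_space"
  assumes "continuous_on (sphere 0 1) f"
  shows "continuous_on S (\<lambda>t. f (exp (\<i> * complex_of_real t)))"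
  by (rule continuous_on_compose2[OF assms]) (auto intro!: continuous_intros)

lemma cinner_trig_op:
  "cinner (trig_op U N t x) (trig_op U N t y) =
    (\<Sum>n=0..N. \<Sum>m=0..N. exp (\<i> * of_real t) powi (int m - int n) * cinner ((U ^^ n) x) ((U ^^ m) y))"
proof -
  have phase: "exp (- \<i> * of_real t * of_nat n) * cnj (exp (- \<i> * of_real t * of_nat m)) =
      exp (\<i> * of_real t) powi (int m - int n)" for n m
    unfolding exp_cnj exp_add[symmetric] exp_power_int by (simp add: algebra_simps)
  thus ?thesis
    unfolding trig_op_def cinner_sum_left unfolding cinner_sum_right
    by (intro sum.cong refl) (simp only: cinner_scaleC_left cinner_scaleC_right phase[symmetric] mult_ac)
qed

lemma continuous_on_cinner_trig_op:
  "continuous_on S (\<lambda>t. cinner (trig_op U N t x) (trig_op U N t y))"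
  unfolding cinner_trig_op exp_power_int by (intro continuous_intros)

text \<open>
  The half-open interval differs from the closed one by a null set. This moves all further
  computations to the gauge integral over a compact interval, where continuous integrands
  are integrable and the fundamental theorem of calculus applies directly.
\<close>
lemma set_lebesgue_integral_Ico_eq_integral:
  fixes g :: "real \<Rightarrow> 'b::euclidean_space"
  assumes "continuous_on {a..b} g"
  shows "(LINT t:{a..<b}|lborel. g t) = integral {a..b} g"
proof -
  have "set_integrable lborel {a..b} g"
    by (rule borel_integrable_atLeastAtMost'[OF assms])
  hence "set_integrable lborel {a..<b} g"
    by (rule set_integrable_subset) auto
  hence "(LINT t:{a..<b}|lborel. g t) = integral {a..<b} g"
    by (rule set_borel_integral_eq_integral)
  also have "\<dots> = integral {a..b} g"
    by (rule integral_subset_negligible) (auto intro: negligible_subset[of "{b}"])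
  finally show ?thesis .
qed

lemma fejer_form_eq_integral:
  assumes "continuous_on (sphere 0 1) f"
  shows "fejer_form U N x y f = 1 / (of_nat N + 1) * (1 / (2 * of_real pi)) *
     integral {0..2 * pi} (\<lambda>t. cinner (trig_op U N t x) (trig_op U N t y) * f (exp (\<i> * of_real t)))"
  unfolding fejer_form_def
  by (subst set_lebesgue_integral_Ico_eq_integral)
     (auto intro!: continuous_intros continuous_on_cinner_trig_op continuous_on_circle_param assms)

lemma fejer_integrand_integrable:
  assumes "continuous_on (sphere 0 1) f"
  shows "(\<lambda>t. cinner (trig_op U N t x) (trig_op U N t y) * f (exp (\<i> * of_real t)))
    integrable_on {a..b}"
  by (intro integrable_continuous_interval continuous_intros continuous_on_cinner_trig_op
      continuous_on_circle_param assms)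

lemma fejer_form_cong:
  assumes "\<And>z. z \<in> sphere 0 1 \<Longrightarrow> f z = g z"
  shows "fejer_form U N x y f = fejer_form U N x y g"
proof -
  have "f (exp (\<i> * of_real t)) = g (exp (\<i> * of_real t))" for t
    by (rule assms) simp
  thus ?thesis
    by (simp add: fejer_form_def)
qed

lemma fejer_form_add:
  assumes "continuous_on (sphere 0 1) f" "continuous_on (sphere 0 1) g"
  shows "fejer_form U N x y (\<lambda>z. f z + g z) = fejer_form U N x y f + fejer_form U N x y g"
  using assms
  by (simp add: fejer_form_eq_integral continuous_on_add distrib_left
      Henstock_Kurzweil_Integration.integral_add fejer_integrand_integrable add_divide_distrib)

lemma fejer_form_cmult:
  "fejer_form U N x y (\<lambda>z. c * f z) = c * fejer_form U N x y f"
  by (simp add: fejer_form_def mult.left_commute[of _ c])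

lemma fejer_form_diff:
  assumes "continuous_on (sphere 0 1) f" "continuous_on (sphere 0 1) g"
  shows "fejer_form U N x y (\<lambda>z. f z - g z) = fejer_form U N x y f - fejer_form U N x y g"
  using fejer_form_add[OF assms(1), of "\<lambda>z. - 1 * g z"] assms(2)
  by (simp add: fejer_form_cmult[of _ _ _ _ "- 1", simplified] continuous_on_minus)

lemma integral_circle_powi:
  "integral {0..2 * pi} (\<lambda>t. exp (\<i> * of_real t) powi k) = (if k = 0 then 2 * of_real pi else 0)"
proof (cases "k = 0")
  case False
  \<comment> \<open>An antiderivative, which exists only for nonzero \<open>k\<close>; it is \<open>2\<pi>\<close>-periodic.\<close>
  define F where "F t = exp (\<i> * of_real t * of_int k) / (\<i> * of_int k)" for t
  have "(F has_vector_derivative exp (\<i> * of_real t) powi k) (at t within S)" for t S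
    unfolding F_def exp_power_int using False
    by (auto intro!: derivative_eq_intros has_vector_derivative_real_field simp: mult_ac)
  hence "((\<lambda>t. exp (\<i> * of_real t) powi k) has_integral (F (2 * pi) - F 0)) {0..2 * pi}"
    by (intro fundamental_theorem_of_calculus) auto
  moreover have "F (2 * pi) = F 0"
    using exp_integer_2pi[of "of_int k"] by (simp add: F_def mult_ac)
  ultimately show ?thesis
    using False by (simp add: integral_unique)
qed (simp add: scaleR_conv_of_real)

text \<open>
  A pair with difference \<open>k\<close> is determined by its smaller entry, which ranges over the numbers below
  \<open>N + 1 - \<bar>k\<bar>\<close>. The truncated subtraction gives the correct count \<open>0\<close> for \<open>\<bar>k\<bar> > N\<close>.
\<close>
lemma card_pairs_with_difference:
  "card {(n, m). n \<in> {0..N} \<and> m \<in> {0..N} \<and> int n - int m = k} = N + 1 - nat \<bar>k\<bar>"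
proof -
  \<comment> \<open>One of \<open>nat k\<close> and \<open>nat (- k)\<close> is zero, so \<open>j\<close> is the smaller entry for either sign of \<open>k\<close>.\<close>
  have "bij_betw (\<lambda>j. (j + nat k, j + nat (- k))) {..<N + 1 - nat \<bar>k\<bar>}
      {(n, m). n \<in> {0..N} \<and> m \<in> {0..N} \<and> int n - int m = k}"
    by (rule bij_betwI[where g = "\<lambda>(n, m). min n m"]) auto
  from bij_betw_same_card[OF this] show ?thesis
    by simp
qed

lemma continuous_on_circle_powi: "continuous_on (sphere 0 1) (\<lambda>z::complex. z powi k)"
  by (intro continuous_intros) auto

text \<open>
  The integral of \<open>e^{it(m - n + k)}\<close> vanishes unless \<open>n - m = k\<close>, so only one diagonal of the double
  sum survives, and its entries are all equal to \<open>w k\<close>. The factor in front is the Cesaro weight.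
\<close>
lemma fejer_form_powi:
  assumes "\<And>n m. cinner ((U ^^ n) x) ((U ^^ m) y) = w (int n - int m)"
  shows "fejer_form U N x y (\<lambda>z. z powi k) = of_nat (N + 1 - nat \<bar>k\<bar>) / (of_nat N + 1) * w k"
proof -
  let ?S = "{(n, m). n \<in> {0..N} \<and> m \<in> {0..N} \<and> int n - int m = k}"
  have shift: "z powi (k - (i - j)) = z powi (j - i) * z powi k" if "z \<noteq> 0" for z :: complex and i j
    using power_int_add[of z "j - i" k] that by (simp add: algebra_simps)
  have "cinner (trig_op U N t x) (trig_op U N t y) * exp (\<i> * of_real t) powi k =
      (\<Sum>n=0..N. \<Sum>m=0..N. w (int n - int m) * exp (\<i> * of_real t) powi (k - (int n - int m)))" for t
    unfolding cinner_trig_op assms sum_distrib_right shift[OF exp_not_eq_zero] by (simp only: mult_ac)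
  moreover have integrable: "(\<lambda>t. c * exp (\<i> * of_real t) powi j) integrable_on {0..2 * pi}"
    for c :: complex and j
    unfolding exp_power_int by (intro integrable_continuous_interval continuous_intros)
  ultimately have "integral {0..2 * pi}
      (\<lambda>t. cinner (trig_op U N t x) (trig_op U N t y) * exp (\<i> * of_real t) powi k) =
    integral {0..2 * pi}
      (\<lambda>t. \<Sum>n=0..N. \<Sum>m=0..N. w (int n - int m) * exp (\<i> * of_real t) powi (k - (int n - int m)))"
    by (simp only:)
  also have "\<dots> = (\<Sum>n=0..N. \<Sum>m=0..N. w (int n - int m) *
      (if k - (int n - int m) = 0 then 2 * of_real pi else 0))"
    by (simp only: Henstock_Kurzweil_Integration.integral_sum integrable_sum finite_atLeastAtMost
        integrable integral_mult_right integral_circle_powi)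
  also have "\<dots> = (\<Sum>(n, m)\<in>{0..N} \<times> {0..N}. if int n - int m = k then 2 * of_real pi * w k else 0)"
    unfolding sum.cartesian_product by (intro sum.cong) auto
  also have "\<dots> = (\<Sum>(n, m)\<in>?S. 2 * of_real pi * w k)"
    by (rule sum.mono_neutral_cong_right) (auto split: if_splits)
  also have "\<dots> = of_nat (N + 1 - nat \<bar>k\<bar>) * (2 * of_real pi * w k)"
    unfolding card_pairs_with_difference[symmetric] by (simp add: split_def)
  finally show ?thesis
    by (simp add: fejer_form_eq_integral continuous_on_circle_powi)
qed

text \<open>
  The estimate that controls all limits below: the bound does not depend on \<open>N\<close>. Pointwise in \<open>t\<close> the
  integrand is at most \<open>M (\<parallel>T_N(t) x\<parallel>\<^sup>2 + \<parallel>T_N(t) y\<parallel>\<^sup>2) / 2\<close>, and the integral of \<open>\<parallel>T_N(t) v\<parallel>\<^sup>2\<close> is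
  known exactly, being the Fejer form of the constant \<open>1 = z^0\<close> up to normalisation. The factor
  \<open>N + 1\<close> that it contributes cancels the one in the definition of the form.
\<close>
lemma cmod_fejer_form_le:
  fixes U :: "'a::complex_hilbert_space \<Rightarrow> 'a"
  assumes "unitary_operator U" "continuous_on (sphere 0 1) f"
    and "\<And>z. z \<in> sphere 0 1 \<Longrightarrow> cmod (f z) \<le> M"
  shows "cmod (fejer_form U N x y f) \<le> M * (((norm x)\<^sup>2 + (norm y)\<^sup>2) / 2)"
proof -
  let ?T = "\<lambda>t x. trig_op U N t x"
  obtain W where W: "W 0 = id"
      "\<And>n m x y. cinner ((U ^^ n) x) ((U ^^ m) y) = cinner (W (int n - int m) x) y"
    using unitary_operator_powersE[OF assms(1)] by metis
  have N1: "complex_of_nat N + 1 \<noteq> 0"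
    using of_nat_neq_0[of N, where 'a = complex] by (simp add: add.commute)
  have cont: "continuous_on S (\<lambda>t. (norm (?T t v))\<^sup>2)" for v S
    using continuous_on_Re[OF continuous_on_cinner_trig_op[of S U N v v]] by (simp add: cinner_self)
  have int: "integral {0..2 * pi} (\<lambda>t. (norm (?T t v))\<^sup>2) = 2 * pi * (N + 1) * (norm v)\<^sup>2" for v
  proof -
    have "complex_of_real (integral {0..2 * pi} (\<lambda>t. (norm (?T t v))\<^sup>2)) =
        integral {0..2 * pi} (\<lambda>t. of_real ((norm (?T t v))\<^sup>2))"
      using integral_linear[OF integrable_continuous_interval[OF cont] bounded_linear_of_real[where 'a = complex]]
      by (simp add: o_def)
    also have "\<dots> = 2 * of_real pi * (of_nat N + 1) * fejer_form U N v v (\<lambda>z. z powi 0)"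
      using N1 by (simp add: fejer_form_eq_integral cinner_self)
    also have "\<dots> = of_real (2 * pi * (N + 1) * (norm v)\<^sup>2)"
      using N1 by (subst fejer_form_powi[OF W(2)]) (simp add: W(1) cinner_self add.commute)
    finally show ?thesis
      by (simp only: of_real_eq_iff)
  qed
  have "cmod (integral {0..2 * pi} (\<lambda>t. cinner (?T t x) (?T t y) * f (exp (\<i> * of_real t))))
      \<le> integral {0..2 * pi} (\<lambda>t. M / 2 * ((norm (?T t x))\<^sup>2 + (norm (?T t y))\<^sup>2))"
  proof (rule integral_norm_bound_integral)
    fix t
    have "cmod (cinner (?T t x) (?T t y)) * cmod (f (exp (\<i> * of_real t)))
        \<le> ((norm (?T t x))\<^sup>2 + (norm (?T t y))\<^sup>2) / 2 * M"
      by (intro mult_mono cmod_cinner_le_mean assms(3)) auto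
    thus "cmod (cinner (?T t x) (?T t y) * f (exp (\<i> * of_real t)))
        \<le> M / 2 * ((norm (?T t x))\<^sup>2 + (norm (?T t y))\<^sup>2)"
      by (simp add: norm_mult mult_ac)
  qed (intro fejer_integrand_integrable[OF assms(2)] integrable_continuous_interval
      continuous_intros cont)+
  also have "\<dots> = M / 2 * (2 * pi * (N + 1) * ((norm x)\<^sup>2 + (norm y)\<^sup>2))"
    by (simp only: integral_mult_right int distrib_left[of _ "(norm x)\<^sup>2"]
        Henstock_Kurzweil_Integration.integral_add[OF integrable_continuous_interval[OF cont]
          integrable_continuous_interval[OF cont]])
  finally have "cmod (integral {0..2 * pi} (\<lambda>t. cinner (?T t x) (?T t y) * f (exp (\<i> * of_real t))))
      / ((N + 1) * (2 * pi)) \<le> M * (((norm x)\<^sup>2 + (norm y)\<^sup>2) / 2)"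
    by (simp add: divide_le_eq mult_ac)
  moreover have weight: "cmod (1 / (of_nat N + 1) * (1 / (2 * of_real pi))) = 1 / ((N + 1) * (2 * pi))"
    using norm_of_nat[of "N + 1", where 'a = complex]
    by (simp add: norm_mult norm_divide add.commute)
  ultimately show ?thesis
    unfolding fejer_form_eq_integral[OF assms(2)]
      norm_mult[of "1 / (of_nat N + 1) * (1 / (2 * of_real pi))"] weight by simp
qed

text \<open>
  The estimate on the forms passes to their limit; for that limit the arithmetic mean of
  the squared norms improves to the product of the norms by the choice of \<open>y\<close> made in
  \<open>norm_le_of_cinner_le_mean\<close>. The vector \<open>a\<close> need not come from an operator, so that the bound
  is available while \<open>f(U)\<close> is still being constructed.
\<close>
lemma norm_le_of_fejer_form_tendsto:
  assumes "unitary_operator U" "continuous_on (sphere 0 1) f"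
    and "\<And>z. z \<in> sphere 0 1 \<Longrightarrow> cmod (f z) \<le> M"
    and "\<And>y. (\<lambda>N. fejer_form U N x y f) \<longlonglongrightarrow> cinner a y"
    and "x = 0 \<Longrightarrow> a = 0"
  shows "norm a \<le> M * norm x"
proof (rule norm_le_of_cinner_le_mean)
  show "cmod (cinner a y) \<le> M * (((norm x)\<^sup>2 + (norm y)\<^sup>2) / 2)" for y
    by (rule LIMSEQ_le_const2[OF tendsto_norm[OF assms(4)]])
       (use cmod_fejer_form_le[OF assms(1-3)] in blast)
  show "0 \<le> M"
    using assms(3)[of 1] norm_ge_zero[of "f 1"] by (simp del: norm_ge_zero)
qed (fact assms(5))

section \<open>Operators representing the limits of the Fejer forms\<close>

text \<open>
  The operator \<open>A\<close> serves as \<open>f(U)\<close>. A relation is used because the existence of such an operator is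
  what has to be shown, for larger and larger classes of functions \<open>f\<close>.
\<close>
definition represents ::
  "('a::complex_hilbert_space \<Rightarrow> 'a) \<Rightarrow> (complex \<Rightarrow> complex) \<Rightarrow> ('a \<Rightarrow> 'a) \<Rightarrow> bool" where
  "represents U f A \<longleftrightarrow>
     bounded_clinear A \<and> (\<forall>x y. (\<lambda>N. fejer_form U N x y f) \<longlonglongrightarrow> cinner (A x) y)"

lemma represents_cong:
  assumes "represents U f A" "\<And>z. z \<in> sphere 0 1 \<Longrightarrow> f z = g z"
  shows "represents U g A"
proof -
  have "fejer_form U N x y f = fejer_form U N x y g" for N x y
    by (rule fejer_form_cong) (fact assms(2))
  thus ?thesis
    using assms(1) by (simp add: represents_def)
qed

lemma represents_cmult:
  assumes "represents U f A"
  shows "represents U (\<lambda>z. c * f z) (\<lambda>x. c *\<^sub>C A x)"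
  using assms unfolding represents_def
  by (auto simp: fejer_form_cmult cinner_scaleC_left intro!: tendsto_intros bounded_clinear_scaleC)

lemma represents_add:
  assumes "represents U f A" "represents U g B"
    and "continuous_on (sphere 0 1) f" "continuous_on (sphere 0 1) g"
  shows "represents U (\<lambda>z. f z + g z) (\<lambda>x. A x + B x)"
  using assms unfolding represents_def
  by (auto simp: fejer_form_add cinner_add_left intro!: tendsto_intros bounded_clinear_add)

lemma represents_diff:
  assumes "represents U f A" "represents U g B"
    and "continuous_on (sphere 0 1) f" "continuous_on (sphere 0 1) g"
  shows "represents U (\<lambda>z. f z - g z) (\<lambda>x. A x - B x)"
  using represents_add[OF assms(1) represents_cmult[OF assms(2), of "- 1"] assms(3)] assms(4)
  by (simp add: uminus_eq_scaleC[symmetric] continuous_on_minus)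

text \<open>
  The operator is \<open>U^k\<close>, since the Cesaro weight \<open>1 - \<bar>k\<bar>/(N + 1)\<close> tends to \<open>1\<close>.
\<close>
lemma represents_powi:
  assumes "unitary_operator U"
  shows "\<exists>A. represents U (\<lambda>z. z powi k) A"
proof -
  obtain W where W: "\<And>k. bounded_clinear (W k)"
      "\<And>n m x y. cinner ((U ^^ n) x) ((U ^^ m) y) = cinner (W (int n - int m) x) y"
    using unitary_operator_powersE[OF assms] by metis
  have "(\<lambda>N. of_real (1 - real (nat \<bar>k\<bar>) / real (Suc N)) :: complex) \<longlonglongrightarrow> of_real (1 - 0)"
    using LIMSEQ_Suc[OF lim_const_over_n[of "real (nat \<bar>k\<bar>)"]]
    by (intro tendsto_of_real tendsto_diff tendsto_const)
  \<comment> \<open>Only eventually, since the subtraction of natural numbers truncates for \<open>N + 1 < \<bar>k\<bar>\<close>.\<close>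
  moreover have "\<forall>\<^sub>F N in sequentially. complex_of_real (1 - real (nat \<bar>k\<bar>) / real (Suc N)) =
      of_nat (N + 1 - nat \<bar>k\<bar>) / (of_nat N + 1)"
    using eventually_ge_at_top[of "nat \<bar>k\<bar>"]
  proof eventually_elim
    case (elim N)
    have "1 - real (nat \<bar>k\<bar>) / real (Suc N) = real (N + 1 - nat \<bar>k\<bar>) / real (Suc N)"
      using elim by (simp add: of_nat_diff field_simps)
    thus ?case
      by (simp add: add.commute)
  qed
  ultimately have weight: "(\<lambda>N. of_nat (N + 1 - nat \<bar>k\<bar>) / (of_nat N + 1) :: complex) \<longlonglongrightarrow> 1"
    using Lim_transform_eventually by fastforce
  have "(\<lambda>N. fejer_form U N x y (\<lambda>z. z powi k)) \<longlonglongrightarrow> cinner (W k x) y" for x y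
    unfolding fejer_form_powi[OF W(2)]
    using tendsto_mult_right[OF weight, of "cinner (W k x) y"] by simp
  thus ?thesis
    using W(1) unfolding represents_def by blast
qed

lemma represents_laurent_polynomial:
  assumes "unitary_operator U"
  shows "\<exists>A. represents U (\<lambda>z. \<Sum>i\<le>(d::nat). c i * z powi k i) A"
proof (induction d)
  case 0
  show ?case
    using represents_powi[OF assms] represents_cmult by force
next
  case (Suc d)
  then obtain A where A: "represents U (\<lambda>z. \<Sum>i\<le>d. c i * z powi k i) A"
    by blast
  obtain B where "represents U (\<lambda>z. z powi k (Suc d)) B"
    using represents_powi[OF assms] by blast
  from represents_add[OF A represents_cmult[OF this, of "c (Suc d)"]]
  have "represents U (\<lambda>z. \<Sum>i\<le>Suc d. c i * z powi k i) (\<lambda>x. A x + c (Suc d) *\<^sub>C B x)"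
    by (simp add: continuous_on_sum continuous_on_mult continuous_on_const continuous_on_circle_powi)
  thus ?case
    by blast
qed

lemma represents_norm_le:
  assumes "unitary_operator U" "represents U f A" "continuous_on (sphere 0 1) f"
    and "\<And>z. z \<in> sphere 0 1 \<Longrightarrow> cmod (f z) \<le> M"
  shows "norm (A x) \<le> M * norm x"
  using assms by (intro norm_le_of_fejer_form_tendsto[where a = "A x" and x = x])
    (auto simp: represents_def bounded_clinear_zero)

text \<open>
  The difference of the operators of \<open>p i\<close> and \<open>p j\<close> represents \<open>p i - p j\<close>, so its norm is at most the
  supremum of \<open>\<bar>p i - p j\<bar>\<close>; hence the operators converge pointwise. That the limit represents \<open>f\<close> is an
  interchange of limits, and linearity and boundedness of the limit follow from those of the operators
  and from the uniform estimate.
\<close>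
lemma represents_uniform_limit:
  fixes U :: "'a::complex_hilbert_space \<Rightarrow> 'a"
  assumes U: "unitary_operator U"
    and A: "\<And>j. represents U (p j) (A j)"
    and p: "\<And>j. continuous_on (sphere 0 1) (p j)"
    and lim: "uniform_limit (sphere 0 1) p f sequentially"
  shows "\<exists>B. represents U f B"
proof -
  have f: "continuous_on (sphere 0 1) f"
    using uniform_limit_theorem[OF _ lim] p by simp
  have "Cauchy (\<lambda>j. A j x)" for x
  proof (rule metric_CauchyI)
    fix e :: real
    assume "0 < e"
    \<comment> \<open>The summand \<open>1\<close> makes \<open>d\<close> meaningful for \<open>x = 0\<close> and the final estimate strict.\<close>
    define d where "d = e / (norm x + 1)"
    have "0 < norm x + 1"
      by (simp add: add_nonneg_pos)
    hence "0 < d"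
      using \<open>0 < e\<close> by (simp add: d_def)
    have "uniformly_Cauchy_on (sphere 0 1) p"
      using lim by (intro uniformly_convergent_Cauchy) (auto simp: uniformly_convergent_on_def)
    then obtain M where M: "\<And>z i j. \<lbrakk>z \<in> sphere 0 1; M \<le> i; M \<le> j\<rbrakk> \<Longrightarrow> dist (p i z) (p j z) < d"
      using \<open>0 < d\<close> unfolding uniformly_Cauchy_on_def by meson
    have "dist (A i x) (A j x) < e" if "M \<le> i" "M \<le> j" for i j
    proof -
      have "norm (A i x - A j x) \<le> d * norm x"
        using M[OF _ that]
        by (intro represents_norm_le[OF U represents_diff[OF A A p p]] continuous_intros p)
           (auto simp: dist_norm intro: less_imp_le)
      also have "\<dots> < d * (norm x + 1)"
        using \<open>0 < d\<close> by simp
      also have "\<dots> = e"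
        using \<open>0 < norm x + 1\<close> by (simp add: d_def)
      finally show ?thesis
        by (simp add: dist_norm)
    qed
    thus "\<exists>M. \<forall>i\<ge>M. \<forall>j\<ge>M. dist (A i x) (A j x) < e"
      by blast
  qed
  then obtain B where B: "\<And>x. (\<lambda>j. A j x) \<longlonglongrightarrow> B x"
    unfolding Cauchy_convergent_iff convergent_def by metis
  have inner: "(\<lambda>j. cinner (A j x) y) \<longlonglongrightarrow> cinner (B x) y" for x y
    by (rule tendsto_cinner_left[OF B])
  have form: "(\<lambda>N. fejer_form U N x y f) \<longlonglongrightarrow> cinner (B x) y" for x y
  proof (rule swap_uniform_limit'[where S = UNIV])
    show "\<forall>\<^sub>F j in sequentially. (\<lambda>N. fejer_form U N x y (p j)) \<longlonglongrightarrow> cinner (A j x) y"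
      using A by (simp add: represents_def)
    show "(\<lambda>j. cinner (A j x) y) \<longlonglongrightarrow> cinner (B x) y"
      by (rule inner)
    show "uniform_limit UNIV (\<lambda>j N. fejer_form U N x y (p j)) (\<lambda>N. fejer_form U N x y f) sequentially"
    proof (rule uniform_limitI)
      fix e :: real
      assume "0 < e"
      define s where "s = ((norm x)\<^sup>2 + (norm y)\<^sup>2) / 2 + 1"
      have "0 < s"
        by (simp add: s_def add_nonneg_pos)
      have "\<forall>\<^sub>F j in sequentially. \<forall>z\<in>sphere 0 1. dist (p j z) (f z) < e / s"
        using \<open>0 < e\<close> \<open>0 < s\<close> by (intro uniform_limitD[OF lim]) simp
      thus "\<forall>\<^sub>F j in sequentially. \<forall>N\<in>UNIV. dist (fejer_form U N x y (p j)) (fejer_form U N x y f) < e"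
      proof eventually_elim
        case (elim j)
        have "dist (fejer_form U N x y (p j)) (fejer_form U N x y f) < e" for N
        proof -
          have "cmod (fejer_form U N x y (\<lambda>z. p j z - f z)) \<le> e / s * (s - 1)"
            using elim unfolding s_def add_diff_cancel_right'
            by (intro cmod_fejer_form_le[OF U]) (auto simp: dist_norm intro!: continuous_intros p f less_imp_le)
          also have "\<dots> < e / s * s"
            using \<open>0 < e\<close> \<open>0 < s\<close> by (intro mult_strict_left_mono) auto
          finally show ?thesis
            using \<open>0 < s\<close> by (simp add: dist_norm fejer_form_diff p f)
        qed
        thus ?case
          by blast
      qed
    qed
  qed auto
  have lin: "bounded_clinear (A j)" for j
    using A by (simp add: represents_def)
  have "B (x + y) = B x + B y" for x y
    using LIMSEQ_unique[OF B[of "x + y"]] tendsto_add[OF B[of x] B[of y]] lin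
    by (simp add: bounded_clinear_iff)
  moreover have "B (c *\<^sub>C x) = c *\<^sub>C B x" for c x
  proof (rule cinner_left_cong)
    fix y
    have "(\<lambda>j. cinner (A j (c *\<^sub>C x)) y) \<longlonglongrightarrow> c * cinner (B x) y"
      using tendsto_mult_left[OF inner[of x y], of c] lin
      by (simp add: bounded_clinear_iff cinner_scaleC_left)
    thus "cinner (B (c *\<^sub>C x)) y = cinner (c *\<^sub>C B x) y"
      using LIMSEQ_unique[OF inner[of "c *\<^sub>C x" y]] by (simp add: cinner_scaleC_left)
  qed
  moreover have "\<exists>K. \<forall>x. norm (B x) \<le> K * norm x"
  proof -
    have "bounded (f ` sphere 0 1)"
      by (intro compact_imp_bounded compact_continuous_image f) simp
    then obtain K where "\<forall>w\<in>f ` sphere 0 1. cmod w \<le> K"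
      unfolding bounded_iff ..
    hence K: "\<And>z. z \<in> sphere 0 1 \<Longrightarrow> cmod (f z) \<le> K"
      by blast
    have "B 0 = 0"
      using LIMSEQ_unique[OF B[of 0]] bounded_clinear_zero[OF lin] by simp
    hence "norm (B x) \<le> K * norm x" for x
      by (intro norm_le_of_fejer_form_tendsto[OF U f K form]) auto
    thus ?thesis
      by blast
  qed
  ultimately show ?thesis
    using form unfolding represents_def bounded_clinear_iff by blast
qed

section \<open>Density of the trigonometric polynomials\<close>

text \<open>
  On the circle \<open>Re z = (z + 1/z)/2\<close> and \<open>Im z = (z - 1/z)/(2\<i>)\<close>, so polynomials in them are Laurent
  polynomials. Clearing the denominator \<open>z^d\<close> states this with ordinary polynomials, for which closure
  under sums and products is immediate.
\<close>
lemma real_polynomial_function_circle_laurent: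
  fixes g :: "complex \<Rightarrow> real"
  assumes "real_polynomial_function g"
  shows "\<exists>d p. \<forall>z\<in>sphere 0 1. z ^ d * of_real (g z) = poly p z"
  using assms
proof (induction g rule: real_polynomial_function.induct)
  case (linear h)
  have "z ^ 1 * of_real (h z) =
      poly [:(of_real (h 1) + \<i> * of_real (h \<i>)) / 2, 0, (of_real (h 1) - \<i> * of_real (h \<i>)) / 2:] z"
    if "z \<in> sphere 0 1" for z
  proof -
    interpret bounded_linear h by fact
    have "z = Re z *\<^sub>R 1 + Im z *\<^sub>R \<i>"
      by (simp add: complex_eq_iff)
    hence "h z = Re z * h 1 + Im z * h \<i>"
      by (metis add scaleR real_scaleR_def)
    hence "z * of_real (h z) =
        of_real (h 1) * (z * of_real (Re z)) + of_real (h \<i>) * (z * of_real (Im z))"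
      by (simp add: distrib_left mult_ac)
    moreover have zz: "z * cnj z = 1"
      using that by (simp add: complex_norm_square[symmetric])
    have "z * of_real (Re z) = (z * z + z * cnj z) / 2"
      by (simp add: complex_eq_iff algebra_simps)
    moreover have "z * of_real (Im z) = \<i> * (z * cnj z - z * z) / 2"
      by (simp add: complex_eq_iff algebra_simps)
    ultimately show ?thesis
      unfolding zz by (simp add: field_simps)
  qed
  thus ?case
    by blast
next
  case (const c)
  have "\<forall>z\<in>sphere 0 1. z ^ 0 * of_real c = poly [:of_real c:] z"
    by simp
  thus ?case
    by blast
next
  case (add f g)
  then obtain d p e q where "\<forall>z\<in>sphere 0 1. z ^ d * of_real (f z) = poly p z"
      "\<forall>z\<in>sphere 0 1. z ^ e * of_real (g z) = poly q z"
    by blast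
  hence "\<forall>z\<in>sphere 0 1. z ^ (d + e) * of_real (f z + g z) = poly (monom 1 e * p + monom 1 d * q) z"
    by (simp add: poly_monom power_add distrib_left ac_simps)
  thus ?case
    by blast
next
  case (mult f g)
  then obtain d p e q where "\<forall>z\<in>sphere 0 1. z ^ d * of_real (f z) = poly p z"
      "\<forall>z\<in>sphere 0 1. z ^ e * of_real (g z) = poly q z"
    by blast
  hence "\<forall>z\<in>sphere 0 1. (z ^ d * of_real (f z)) * (z ^ e * of_real (g z)) = poly p z * poly q z"
    by simp
  hence "\<forall>z\<in>sphere 0 1. z ^ (d + e) * of_real (f z * g z) = poly (p * q) z"
    by (simp add: power_add mult_ac)
  thus ?case
    by blast
qed

lemma polynomial_function_circle_laurent:
  fixes g :: "complex \<Rightarrow> complex"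
  assumes "polynomial_function g"
  shows "\<exists>(d::nat) c k. \<forall>z\<in>sphere 0 1. g z = (\<Sum>i\<le>d. c i * z powi k i)"
proof -
  have "real_polynomial_function (Re \<circ> g)" "real_polynomial_function (Im \<circ> g)"
    using assms bounded_linear_Re bounded_linear_Im unfolding polynomial_function_def by blast+
  then obtain d p e q where *: "\<forall>z\<in>sphere 0 1. z ^ d * of_real (Re (g z)) = poly p z"
      "\<forall>z\<in>sphere 0 1. z ^ e * of_real (Im (g z)) = poly q z"
    using real_polynomial_function_circle_laurent by (metis comp_apply)
  define r where "r = monom 1 e * p + smult \<i> (monom 1 d * q)"
  have "g z = (\<Sum>i\<le>degree r. coeff r i * z powi (int i - int (d + e)))" if z: "z \<in> sphere 0 1" for z
  proof -
    have "z \<noteq> 0"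
      using z by auto
    have "z ^ (d + e) * g z =
        z ^ e * (z ^ d * of_real (Re (g z))) + \<i> * (z ^ d * (z ^ e * of_real (Im (g z))))"
      by (subst complex_eq[of "g z"]) (simp add: power_add algebra_simps)
    also have "\<dots> = poly r z"
      using * z by (simp add: r_def poly_monom)
    finally have "g z = poly r z / z ^ (d + e)"
      using \<open>z \<noteq> 0\<close> by (simp add: field_simps)
    thus ?thesis
      using \<open>z \<noteq> 0\<close>
      by (simp add: poly_altdef sum_divide_distrib power_int_diff power_int_add power_add)
  qed
  thus ?thesis
    by (intro exI[of _ "degree r"] exI[of _ "coeff r"] exI[of _ "\<lambda>i. int i - int (d + e)"]) blast
qed

theorem theorem2p2:
  fixes U :: "'a::complex_hilbert_space \<Rightarrow> 'a"
  assumes "unitary_operator U"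
  shows "\<forall>f :: complex \<Rightarrow> complex. continuous_on (sphere 0 1) f \<longrightarrow>
    (\<exists>fU :: 'a \<Rightarrow> 'a. bounded_clinear fU \<and>
      (\<forall>x y. (\<lambda>N. fejer_form U N x y f) \<longlonglongrightarrow> cinner (fU x) y))"
proof (intro allI impI)
  fix f :: "complex \<Rightarrow> complex"
  assume f: "continuous_on (sphere 0 1) f"
  obtain p where p: "\<And>j. polynomial_function (p j)" "uniform_limit (sphere 0 1) p f sequentially"
    using Stone_Weierstrass_uniform_limit[OF _ f] by auto
  have "\<exists>A. represents U (p j) A" for j
  proof -
    obtain d c k where eq: "\<forall>z\<in>sphere 0 1. p j z = (\<Sum>i\<le>(d::nat). c i * z powi k i)"
      using polynomial_function_circle_laurent[OF p(1)] by blast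
    obtain A where A: "represents U (\<lambda>z. \<Sum>i\<le>d. c i * z powi k i) A"
      using represents_laurent_polynomial[OF assms] by blast
    have "represents U (p j) A"
      by (rule represents_cong[OF A]) (use eq in simp)
    thus ?thesis
      by blast
  qed
  then obtain A where "\<And>j. represents U (p j) (A j)"
    by metis
  moreover have "continuous_on (sphere 0 1) (p j)" for j
    by (rule continuous_on_polymonial_function[OF p(1)])
  ultimately obtain B where "represents U f B"
    using represents_uniform_limit[OF assms _ _ p(2)] by blast
  thus "\<exists>fU. bounded_clinear fU \<and> (\<forall>x y. (\<lambda>N. fejer_form U N x y f) \<longlonglongrightarrow> cinner (fU x) y)"
    unfolding represents_def by blast
qed

end
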